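(* Let $1\le r<\infty$, let $[a,b]$ be a compact interval, and let $f\colon[a,b]\to\mathbb R$. Then $f$ is $HK_r$-integrable on $[a,b]$ if and only if there exists an $ACG_r$-function $F$ on $[a,b]$ such that $F_r'(x)=f(x)$ for almost every $x\in[a,b]$. Moreover, for such $F$, the function $x\mapsto F(x)-F(a)$ is the indefinite $HK_r$-integral of $f$.
   Context: Functions are real-valued and defined at every point of $[a,b]$ (so $F\in L^r=L^r[a,b]$ means a function $F\colon[a,b]\to\mathbb R$ that is measurable with $|F|^r$ Lebesgue integrable; pointwise values matter). An interval is a non-degenerate closed subinterval of $[a,b]$. "Almost every" refers to Lebesgue measure. $L^r$-derivative: $F\in L^r$ is $L^r$-differentiable at $x$ if there is a real number $\alpha$ with $\left(\frac1h\int_{-h}^{h}|F(x+t)-F(x)-\alpha t|^r\,dt\right)^{1/r}=o(h)$ as $h\to0^+$; this $\alpha$ is unique and is denoted $F_r'(x)$. A tagged interval is a pair $(I,x)$ with $I$ an interval and $x\in I$. A partition is a finite collection of tagged intervals whose intervals are pairwise nonoverlapping (no common interior points); it is tagged in $E$ if all tags lie in $E$. A gauge on $E\subset[a,b]$ is a strictly positive function $\delta$ on $E$. A tagged interval $(I,x)$ is $\delta$-fine if $I\subset(x-\delta(x),x+\delta(x))$, and a partition is $\delta$-fine if all its elements are. $f\colon[a,b]\to\mathbb R$ is $HK_r$-integrable on $[a,b]$ if there exists $F\in L^r$ such that for every $\varepsilon>0$ there is a gauge $\delta$ on $[a,b]$ such that for every $\delta$-fine partition $\{([c_i,d_i],x_i)\}_i$,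 $\sum_i\left(\frac1{d_i-c_i}\int_{c_i}^{d_i}|F(y)-F(x_i)-f(x_i)(y-x_i)|^r\,dy\right)^{1/r}<\varepsilon$. Such an $F$ is unique up to an additive constant; the one normalized by $F(a)=0$ is called the indefinite $HK_r$-integral of $f$. For $E\subset[a,b]$ and $F\in L^r$, $F\in AC_r(E)$ means: for each $\varepsilon>0$ there exist $\eta>0$ and a gauge $\delta$ on $E$ such that for every $\delta$-fine partition $\{([c_i,d_i],x_i)\}_i$ tagged in $E$ with $\sum_i(d_i-c_i)<\eta$ one has $\sum_i\left(\frac1{d_i-c_i}\int_{c_i}^{d_i}|F(y)-F(x_i)|^r\,dy\right)^{1/r}<\varepsilon$. $F\in L^r$ is an $ACG_r$-function if $[a,b]=\bigcup_{n=1}^\infty E_n$ for some sets $E_n$ with $F\in AC_r(E_n)$ for all $n$. *)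

theory Defs
  imports "HOL-Analysis.Analysis" "HOL-Library.Landau_Symbols"
begin

text \<open>
  A function on \<open>[a,b]\<close> is represented by a total function of type \<^typ>\<open>real \<Rightarrow> real\<close>; no
  definition below depends on its values outside \<open>{a..b}\<close>. Functions are not identified
  when they agree almost everywhere.
\<close>

definition Lr :: "real \<Rightarrow> real \<Rightarrow> real \<Rightarrow> (real \<Rightarrow> real) set" where
  "Lr r a b = {F. set_borel_measurable lebesgue {a..b} F \<and>
                  set_integrable lebesgue {a..b} (\<lambda>x. \<bar>F x\<bar> powr r)}"

text \<open>
  The point \<open>x\<close> is required to be interior, so that \<open>F (x + t)\<close> is meaningful
  for all \<open>t \<in> {-h..h}\<close> once \<open>h\<close> is small.
\<close>

definition has_Lr_derivative ::
    "real \<Rightarrow> real \<Rightarrow> real \<Rightarrow> (real \<Rightarrow> real) \<Rightarrow> real \<Rightarrow> real \<Rightarrow> bool" where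
  "has_Lr_derivative r a b F \<alpha> x \<longleftrightarrow>
     F \<in> Lr r a b \<and> x \<in> {a<..<b} \<and>
     (\<lambda>h. (1 / h * (LINT t:{-h..h}|lebesgue. \<bar>F (x + t) - F x - \<alpha> * t\<bar> powr r)) powr (1 / r))
       \<in> o[at_right 0](\<lambda>h. h)"

text \<open>
  The library's partial divisions may contain degenerate intervals \<open>{c..c}\<close>; these are excluded
  here. A gauge is a positive function \<open>\<delta>\<close>, and \<open>ball x (\<delta> x)\<close> is the open
  interval from \<open>x - \<delta> x\<close> to \<open>x + \<delta> x\<close>.
\<close>

definition fine_partition ::
    "real \<Rightarrow> real \<Rightarrow> real set \<Rightarrow> (real \<Rightarrow> real) \<Rightarrow> (real \<times> real set) set \<Rightarrow> bool" where
  "fine_partition a b E \<delta> p \<longleftrightarrow>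
     p tagged_partial_division_of {a..b} \<and>
     (\<forall>(x, K) \<in> p. interior K \<noteq> {}) \<and>
     (\<forall>(x, K) \<in> p. x \<in> E) \<and>
     (\<lambda>x. ball x (\<delta> x)) fine p"

definition Lr_mean :: "real \<Rightarrow> real set \<Rightarrow> (real \<Rightarrow> real) \<Rightarrow> real" where
  "Lr_mean r K g = (1 / measure lborel K * (LINT y:K|lebesgue. \<bar>g y\<bar> powr r)) powr (1 / r)"

definition HKr_primitive ::
    "real \<Rightarrow> real \<Rightarrow> real \<Rightarrow> (real \<Rightarrow> real) \<Rightarrow> (real \<Rightarrow> real) \<Rightarrow> bool" where
  "HKr_primitive r a b f F \<longleftrightarrow>
     F \<in> Lr r a b \<and>
     (\<forall>\<epsilon>>0. \<exists>\<delta>. (\<forall>x\<in>{a..b}. 0 < \<delta> x) \<and>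
        (\<forall>p. fine_partition a b {a..b} \<delta> p \<longrightarrow>
           (\<Sum>(x, K)\<in>p. Lr_mean r K (\<lambda>y. F y - F x - f x * (y - x))) < \<epsilon>))"

definition HKr_integrable :: "real \<Rightarrow> real \<Rightarrow> real \<Rightarrow> (real \<Rightarrow> real) \<Rightarrow> bool" where
  "HKr_integrable r a b f \<longleftrightarrow> (\<exists>F. HKr_primitive r a b f F)"

text \<open>
  The indefinite integral is given as a relation, in the style of \<open>has_integral\<close>: as a
  function of type \<^typ>\<open>real \<Rightarrow> real\<close> it is determined on \<open>{a..b}\<close> only.
\<close>

definition has_indefinite_HKr_integral ::
    "real \<Rightarrow> real \<Rightarrow> real \<Rightarrow> (real \<Rightarrow> real) \<Rightarrow> (real \<Rightarrow> real) \<Rightarrow> bool" where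
  "has_indefinite_HKr_integral r a b f F \<longleftrightarrow> HKr_primitive r a b f F \<and> F a = 0"

definition ACr :: "real \<Rightarrow> real \<Rightarrow> real \<Rightarrow> real set \<Rightarrow> (real \<Rightarrow> real) set" where
  "ACr r a b E = {F. E \<subseteq> {a..b} \<and> F \<in> Lr r a b \<and>
     (\<forall>\<epsilon>>0. \<exists>\<eta>>0. \<exists>\<delta>. (\<forall>x\<in>E. 0 < \<delta> x) \<and>
        (\<forall>p. fine_partition a b E \<delta> p \<and> (\<Sum>(x, K)\<in>p. measure lborel K) < \<eta> \<longrightarrow>
           (\<Sum>(x, K)\<in>p. Lr_mean r K (\<lambda>y. F y - F x)) < \<epsilon>))}"

definition ACGr :: "real \<Rightarrow> real \<Rightarrow> real \<Rightarrow> (real \<Rightarrow> real) set" where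
  "ACGr r a b = {F. F \<in> Lr r a b \<and>
     (\<exists>E :: nat \<Rightarrow> real set. {a..b} = (\<Union>n. E n) \<and> (\<forall>n. F \<in> ACr r a b (E n)))}"

end

theory Submission
  imports Defs
begin

text \<open>
  Write \<open>M(K, g)\<close> for the mean of order \<open>r\<close> of \<open>g\<close> over an interval \<open>K\<close>. Two quantities are
  attached to a tagged interval: the error \<open>M(K, F y - F x - f x * (y - x))\<close>, whose sums define
  the integral, and the increment \<open>M(K, F y - F x)\<close>, whose sums define absolute continuity. Up
  to a constant factor, each is at most the other plus \<open>\<bar>f x\<bar>\<close> times the length of \<open>K\<close>
  (\<open>Lr_mean_increment_le\<close>, \<open>Lr_mean_error_le\<close>), so on a set where \<open>f\<close> is bounded, smallness of one is equivalent to
  smallness of the other as long as the total length is small. This is the mechanism behind both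
  directions.

  Let \<open>F\<close> be a primitive of \<open>f\<close>. The level sets \<open>\<bar>f\<bar> \<le> n\<close> exhaust \<open>{a..b}\<close>, and on each of them
  \<open>F\<close> is absolutely continuous by the comparison just described (\<open>HKr_primitive_imp_ACGr\<close>). At a
  point where \<open>f x\<close> fails to be the derivative, the error on arbitrarily small symmetric intervals
  exceeds a positive multiple of their length, and countably many values of this multiple suffice.
  For each value, Vitali's covering theorem selects disjoint such intervals that cover almost all of
  the points in question. Finitely many of them form a fine partition, so their errors, and
  therefore their lengths, have an arbitrarily small sum (\<open>negligible_large_error\<close>).

  Conversely, let \<open>F\<close> be generalised absolutely continuous with derivative \<open>f\<close> almost everywhere.
  Tags at which \<open>F\<close> is differentiable contribute errors that are small multiples of the lengths
  (\<open>derivative_gauge\<close>). The remaining tags lie in a null set. It is a countable union of pieces on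
  which \<open>F\<close> is absolutely continuous and \<open>f\<close> is bounded, and intervals kept inside a small open
  neighbourhood of a piece have small total length; so each piece contributes a small error
  (\<open>ACr_null_gauge\<close>), and these errors can be made summable. Hence \<open>F\<close> is a primitive of \<open>f\<close>
  (\<open>HKr_primitive_if_AE_derivative\<close>), and subtracting \<open>F a\<close> changes no error.
\<close>

section \<open>The space of r-integrable functions\<close>

lemma indicator_abs_powr:
  "indicator A x *\<^sub>R (\<bar>F x\<bar> powr r) = \<bar>indicator A x *\<^sub>R F x\<bar> powr r" for F :: "real \<Rightarrow> real"
  by (auto simp: indicator_def)

lemma Lr_iff:
  "F \<in> Lr r a b \<longleftrightarrow> (\<lambda>x. indicator {a..b} x *\<^sub>R F x) \<in> borel_measurable lebesgue \<and>
     integrable lebesgue (\<lambda>x. \<bar>indicator {a..b} x *\<^sub>R F x\<bar> powr r)"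
  by (simp only: Lr_def set_borel_measurable_def set_integrable_def indicator_abs_powr mem_Collect_eq)

lemma Lr_set_integrable: "F \<in> Lr r a b \<Longrightarrow> set_integrable lebesgue {a..b} (\<lambda>x. \<bar>F x\<bar> powr r)"
  by (simp add: Lr_def)

lemma Lr_subset:
  assumes "F \<in> Lr r a b" "{c..d} \<subseteq> {a..b}"
  shows "F \<in> Lr r c d"
proof -
  have "(\<lambda>x. indicator {c..d} x *\<^sub>R (indicator {a..b} x *\<^sub>R F x)) \<in> borel_measurable lebesgue"
  proof (rule borel_measurable_scaleR)
    show "(\<lambda>x. indicator {a..b} x *\<^sub>R F x) \<in> borel_measurable lebesgue"
      using assms(1) unfolding Lr_iff by blast
    show "indicator {c..d} \<in> borel_measurable lebesgue"
      by (rule borel_measurable_indicator) simp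
  qed
  moreover have "(\<lambda>x. indicator {c..d} x *\<^sub>R (indicator {a..b} x *\<^sub>R F x)) = (\<lambda>x. indicator {c..d} x *\<^sub>R F x)"
    using assms(2) by (auto simp: indicator_def fun_eq_iff)
  moreover have "set_integrable lebesgue {c..d} (\<lambda>x. \<bar>F x\<bar> powr r)"
    using set_integrable_subset[OF Lr_set_integrable[OF assms(1)] _ assms(2)] by simp
  ultimately show ?thesis by (simp add: Lr_def set_borel_measurable_def)
qed

text \<open>
  A crude stand-in for convexity when \<open>p \<ge> 1\<close> and for subadditivity when \<open>p \<le> 1\<close>: it covers
  both ranges at once because \<open>u + v\<close> is at most twice the larger summand.
\<close>

lemma powr_add_le:
  fixes u v p :: real
  assumes "0 \<le> u" "0 \<le> v" "0 \<le> p"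
  shows "(u + v) powr p \<le> 2 powr p * (u powr p + v powr p)"
proof -
  have "(u + v) powr p \<le> (2 * max u v) powr p"
    using assms by (intro powr_mono2) auto
  also have "\<dots> = 2 powr p * (max u v) powr p"
    using assms by (simp add: powr_mult)
  also have "(max u v) powr p \<le> u powr p + v powr p"
    by (simp add: max_def)
  finally show ?thesis by simp
qed

lemma abs_add_powr_le:
  fixes u v r :: real
  assumes "0 \<le> r"
  shows "\<bar>u + v\<bar> powr r \<le> 2 powr r * (\<bar>u\<bar> powr r + \<bar>v\<bar> powr r)"
proof -
  have "\<bar>u + v\<bar> powr r \<le> (\<bar>u\<bar> + \<bar>v\<bar>) powr r"
    using assms by (intro powr_mono2) auto
  also have "\<dots> \<le> 2 powr r * (\<bar>u\<bar> powr r + \<bar>v\<bar> powr r)"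
    using assms by (intro powr_add_le) auto
  finally show ?thesis .
qed

lemma Lr_add:
  assumes "0 \<le> r" "F \<in> Lr r a b" "G \<in> Lr r a b"
  shows "(\<lambda>x. F x + G x) \<in> Lr r a b"
proof -
  let ?F = "\<lambda>x. indicator {a..b} x *\<^sub>R F x" and ?G = "\<lambda>x. indicator {a..b} x *\<^sub>R G x"
  have meas: "?F \<in> borel_measurable lebesgue" "?G \<in> borel_measurable lebesgue"
    using assms by (auto simp: Lr_iff)
  have "integrable lebesgue (\<lambda>x. 2 powr r * (\<bar>?F x\<bar> powr r + \<bar>?G x\<bar> powr r))"
    using assms by (intro integrable_mult_right Bochner_Integration.integrable_add) (auto simp: Lr_iff)
  then have "integrable lebesgue (\<lambda>x. \<bar>?F x + ?G x\<bar> powr r)"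
  proof (rule Bochner_Integration.integrable_bound)
    show "(\<lambda>x. \<bar>?F x + ?G x\<bar> powr r) \<in> borel_measurable lebesgue"
      using meas by measurable
    show "AE x in lebesgue. norm (\<bar>?F x + ?G x\<bar> powr r) \<le> norm (2 powr r * (\<bar>?F x\<bar> powr r + \<bar>?G x\<bar> powr r))"
    proof (rule AE_I2)
      fix x
      show "norm (\<bar>?F x + ?G x\<bar> powr r) \<le> norm (2 powr r * (\<bar>?F x\<bar> powr r + \<bar>?G x\<bar> powr r))"
        using abs_add_powr_le[OF assms(1), of "?F x" "?G x"]
        by (simp del: real_scaleR_def)
    qed
  qed
  moreover have "(\<lambda>x. ?F x + ?G x) \<in> borel_measurable lebesgue"
    using meas by measurable
  ultimately show ?thesis by (simp add: Lr_iff scaleR_add_right del: real_scaleR_def)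
qed

lemma Lr_continuous:
  assumes "0 < r" "continuous_on {a..b} g"
  shows "g \<in> Lr r a b"
proof -
  have "set_integrable lborel {a..b} (\<lambda>x. \<bar>g x\<bar> powr r)"
    using assms by (intro borel_integrable_atLeastAtMost' continuous_intros continuous_on_powr') auto
  then have "set_integrable lebesgue {a..b} (\<lambda>x. \<bar>g x\<bar> powr r)"
    unfolding set_integrable_def by (simp add: integrable_completion borel_measurable_integrable)
  moreover have "(\<lambda>x. indicator {a..b} x *\<^sub>R g x) \<in> borel_measurable lborel"
    using assms(2) by (simp add: borel_measurable_continuous_on_indicator del: real_scaleR_def)
  then have "set_borel_measurable lebesgue {a..b} g"
    unfolding set_borel_measurable_def by (rule measurable_completion)
  ultimately show ?thesis by (simp add: Lr_def)
qed

lemma Lr_add_affine: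
  assumes "0 < r" "F \<in> Lr r a b"
  shows "(\<lambda>y. F y - c - m * (y - x)) \<in> Lr r a b"
proof -
  have "(\<lambda>y. - c - m * (y - x)) \<in> Lr r a b"
    using assms(1) by (intro Lr_continuous continuous_intros)
  then have "(\<lambda>y. F y + (- c - m * (y - x))) \<in> Lr r a b"
    using assms by (intro Lr_add) auto
  then show ?thesis by (simp add: algebra_simps)
qed

section \<open>Mean values of order r\<close>

lemma Lr_mean_nonneg: "0 \<le> Lr_mean r K g"
  by (simp add: Lr_mean_def)

lemma Lr_mean_minus_Icc:
  "c \<le> d \<Longrightarrow> Lr_mean r {c..d} g = (1 / (d - c) * (LINT y:{c..d}|lebesgue. \<bar>g y\<bar> powr r)) powr (1 / r)"
  by (simp add: Lr_mean_def)

text \<open>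
  The triangle inequality with the constant 4 in place of Minkowski's 1. Every estimate below
  concerns a quantity that has to be made arbitrarily small, so a constant factor is harmless, and
  this form needs only \<open>powr_add_le\<close>, once with the exponent \<open>r\<close> and once with \<open>1 / r\<close>.
\<close>

lemma Lr_mean_add_le:
  assumes "1 \<le> r" "c < d" "F \<in> Lr r c d" "G \<in> Lr r c d"
  shows "Lr_mean r {c..d} (\<lambda>y. F y + G y) \<le> 4 * (Lr_mean r {c..d} F + Lr_mean r {c..d} G)"
proof -
  let ?I = "\<lambda>F. 1 / (d - c) * (LINT y:{c..d}|lebesgue. \<bar>F y\<bar> powr r)"
  have nn: "0 \<le> ?I F" for F :: "real \<Rightarrow> real"
    using assms(2) by (auto simp: set_lebesgue_integral_def intro!: integral_nonneg_AE divide_nonneg_nonneg)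
  have int: "set_integrable lebesgue {c..d} (\<lambda>y. \<bar>F y\<bar> powr r)"
      "set_integrable lebesgue {c..d} (\<lambda>y. \<bar>G y\<bar> powr r)"
      "set_integrable lebesgue {c..d} (\<lambda>y. \<bar>F y + G y\<bar> powr r)"
    using assms by (auto intro!: Lr_set_integrable Lr_add)
  have "(LINT y:{c..d}|lebesgue. \<bar>F y + G y\<bar> powr r) \<le>
      (LINT y:{c..d}|lebesgue. 2 powr r * (\<bar>F y\<bar> powr r + \<bar>G y\<bar> powr r))"
    using assms int by (intro set_integral_mono set_integrable_mult_right set_integral_add abs_add_powr_le) auto
  also have "\<dots> = 2 powr r * ((LINT y:{c..d}|lebesgue. \<bar>F y\<bar> powr r) + (LINT y:{c..d}|lebesgue. \<bar>G y\<bar> powr r))"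
    using int by (simp add: set_integral_add)
  finally have "(LINT y:{c..d}|lebesgue. \<bar>F y + G y\<bar> powr r) \<le> \<dots>" .
  from mult_left_mono[OF this, of "1 / (d - c)"]
  have "?I (\<lambda>y. F y + G y) \<le> 2 powr r * (?I F + ?I G)"
    using assms(2) by (simp add: distrib_left add_divide_distrib mult_ac)
  then have "?I (\<lambda>y. F y + G y) powr (1/r) \<le> (2 powr r * (?I F + ?I G)) powr (1/r)"
    using assms(1) nn by (intro powr_mono2) auto
  also have "\<dots> = 2 * (?I F + ?I G) powr (1/r)"
    using assms(1) by (simp add: powr_mult powr_powr)
  also have "(?I F + ?I G) powr (1/r) \<le> 2 powr (1/r) * (?I F powr (1/r) + ?I G powr (1/r))"
    using assms(1) nn by (intro powr_add_le) auto
  also have "2 powr (1/r) * (?I F powr (1/r) + ?I G powr (1/r)) \<le> 2 powr 1 * (?I F powr (1/r) + ?I G powr (1/r))"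
    using assms(1) by (intro mult_right_mono powr_mono) auto
  finally show ?thesis using assms(2) by (simp add: Lr_mean_minus_Icc)
qed

lemma Lr_mean_linear_le:
  assumes "0 < r" "c < d" "x \<in> {c..d}"
  shows "Lr_mean r {c..d} (\<lambda>y. m * (y - x)) \<le> \<bar>m\<bar> * (d - c)"
proof -
  let ?B = "(\<bar>m\<bar> * (d - c)) powr r"
  have "(LINT y:{c..d}|lebesgue. \<bar>m * (y - x)\<bar> powr r) \<le> (LINT y:{c..d}|lebesgue. ?B)"
  proof (rule set_integral_mono)
    show "set_integrable lebesgue {c..d} (\<lambda>y. \<bar>m * (y - x)\<bar> powr r)"
      using assms(1) by (intro Lr_set_integrable Lr_continuous continuous_intros)
    have "(\<lambda>_. \<bar>m\<bar> * (d - c)) \<in> Lr r c d"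
      using assms(1) by (intro Lr_continuous continuous_intros)
    from Lr_set_integrable[OF this] show "set_integrable lebesgue {c..d} (\<lambda>y. ?B)"
      using assms(2) by (simp add: abs_mult)
    show "\<bar>m * (y - x)\<bar> powr r \<le> ?B" if "y \<in> {c..d}" for y
      using that assms by (intro powr_mono2) (auto simp: abs_mult intro!: mult_left_mono)
  qed
  also have "\<dots> = (d - c) * ?B"
    using assms(2) by (simp add: set_lebesgue_integral_def)
  finally have "1 / (d - c) * (LINT y:{c..d}|lebesgue. \<bar>m * (y - x)\<bar> powr r) \<le> ?B"
    using assms(2) by (simp add: field_simps)
  then have "Lr_mean r {c..d} (\<lambda>y. m * (y - x)) \<le> ?B powr (1/r)"
    using assms unfolding Lr_mean_minus_Icc[OF less_imp_le[OF assms(2)]]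
    by (intro powr_mono2) (auto simp: set_lebesgue_integral_def intro!: integral_nonneg_AE divide_nonneg_nonneg)
  also have "\<dots> = \<bar>m\<bar> * (d - c)"
    using assms by (simp add: powr_powr)
  finally show ?thesis .
qed

text \<open>
  Enlarging the interval enlarges the integral and at most halves the normalising factor. This is
  how an arbitrary interval around a tag is compared with the symmetric one in the definition of the
  derivative.
\<close>

lemma Lr_mean_subinterval_le:
  assumes "1 \<le> r" "c < d" "{c..d} \<subseteq> {u..v}" "v - u \<le> 2 * (d - c)" "g \<in> Lr r u v"
  shows "Lr_mean r {c..d} g \<le> 2 * Lr_mean r {u..v} g"
proof -
  let ?I = "\<lambda>A. LINT y:A|lebesgue. \<bar>g y\<bar> powr r"
  have uv: "u \<le> c" "d \<le> v" "u < v" using assms(2,3) by auto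
  have int: "set_integrable lebesgue {u..v} (\<lambda>y. \<bar>g y\<bar> powr r)"
      "set_integrable lebesgue {c..d} (\<lambda>y. \<bar>g y\<bar> powr r)"
    using assms(3,5) by (auto intro!: Lr_set_integrable intro: Lr_subset)
  have nn: "0 \<le> ?I A" for A
    by (auto simp: set_lebesgue_integral_def intro!: integral_nonneg_AE)
  have "?I {c..d} \<le> ?I {u..v}"
    using int assms(3) unfolding set_lebesgue_integral_def set_integrable_def
    by (intro integral_mono) (auto simp: indicator_def)
  then have "1 / (d - c) * ?I {c..d} \<le> 2 / (v - u) * ?I {u..v}"
    using assms(2,4) uv nn by (intro mult_mono) (auto simp: field_simps)
  then have "Lr_mean r {c..d} g \<le> (2 * (1 / (v - u) * ?I {u..v})) powr (1/r)"
    using assms(1,2) nn unfolding Lr_mean_minus_Icc[OF less_imp_le[OF assms(2)]]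
    by (intro powr_mono2) auto
  also have "\<dots> = 2 powr (1/r) * Lr_mean r {u..v} g"
    using uv nn by (simp only: Lr_mean_minus_Icc less_imp_le powr_mult)
  also have "\<dots> \<le> 2 powr 1 * Lr_mean r {u..v} g"
    using assms(1) by (intro mult_right_mono powr_mono Lr_mean_nonneg) auto
  finally show ?thesis by simp
qed

text \<open>
  The increment of \<open>F\<close> that governs absolute continuity and the approximation error that governs
  integrability come from functions that differ by the linear term \<open>m * (y - x)\<close>, whose mean is at most \<open>\<bar>m\<bar>\<close> times the
  length of the interval. So, in this lemma and the next, each controls the other up to a constant
  factor and a multiple of the length.
\<close>

lemma Lr_mean_increment_le:
  assumes "1 \<le> r" "c < d" "x \<in> {c..d}" "F \<in> Lr r c d"
  shows "Lr_mean r {c..d} (\<lambda>y. F y - F x) \<le>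
    4 * (Lr_mean r {c..d} (\<lambda>y. F y - F x - m * (y - x)) + \<bar>m\<bar> * (d - c))"
proof -
  have lin: "(\<lambda>y. m * (y - x)) \<in> Lr r c d"
    using assms(1) by (intro Lr_continuous continuous_intros) auto
  have "Lr_mean r {c..d} (\<lambda>y. (F y - F x - m * (y - x)) + m * (y - x)) \<le>
      4 * (Lr_mean r {c..d} (\<lambda>y. F y - F x - m * (y - x)) + Lr_mean r {c..d} (\<lambda>y. m * (y - x)))"
    using assms lin by (intro Lr_mean_add_le Lr_add_affine) auto
  then show ?thesis
    using Lr_mean_linear_le[of r c d x m] assms by simp
qed

lemma Lr_mean_error_le:
  assumes "1 \<le> r" "c < d" "x \<in> {c..d}" "F \<in> Lr r c d"
  shows "Lr_mean r {c..d} (\<lambda>y. F y - F x - m * (y - x)) \<le>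
    4 * (Lr_mean r {c..d} (\<lambda>y. F y - F x) + \<bar>m\<bar> * (d - c))"
proof -
  have lin: "(\<lambda>y. (- m) * (y - x)) \<in> Lr r c d"
    using assms(1) by (intro Lr_continuous continuous_intros) auto
  have "Lr_mean r {c..d} (\<lambda>y. (F y - F x - 0 * (y - x)) + (- m) * (y - x)) \<le>
      4 * (Lr_mean r {c..d} (\<lambda>y. F y - F x - 0 * (y - x)) + Lr_mean r {c..d} (\<lambda>y. (- m) * (y - x)))"
    using assms lin by (intro Lr_mean_add_le Lr_add_affine) auto
  then show ?thesis
    using Lr_mean_linear_le[of r c d x "- m"] assms by simp
qed

section \<open>The derivative as a statement about symmetric means\<close>

lemma Lr_mean_symmetric:
  assumes "0 < h"
  shows "(1 / h * (LINT t:{-h..h}|lebesgue. \<bar>g (x + t)\<bar> powr r)) powr (1 / r)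
    = 2 powr (1 / r) * Lr_mean r {x - h..x + h} g"
proof -
  have "(LINT y:{x-h..x+h}|lebesgue. \<bar>g y\<bar> powr r)
     = (LINT t|lebesgue. indicator {x-h..x+h} (x + 1 * t) *\<^sub>R (\<bar>g (x + 1 * t)\<bar> powr r))"
    unfolding set_lebesgue_integral_def
    by (subst lebesgue_integral_real_affine[where c=1 and t=x]) simp_all
  also have "\<dots> = (LINT t:{-h..h}|lebesgue. \<bar>g (x + t)\<bar> powr r)"
    unfolding set_lebesgue_integral_def
    by (intro Bochner_Integration.integral_cong) (auto simp: indicator_def)
  finally have "Lr_mean r {x - h..x + h} g
      = (1 / (2 * h) * (LINT t:{-h..h}|lebesgue. \<bar>g (x + t)\<bar> powr r)) powr (1 / r)"
    using assms by (simp add: Lr_mean_minus_Icc)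
  then show ?thesis using assms
    by (simp flip: powr_mult)
qed

text \<open>
  Translating the window to \<open>{x - h..x + h}\<close> turns the average in the definition, which is
  normalised by \<open>1 / h\<close> and not by the length \<open>2 * h\<close>, into a constant multiple of a mean. The
  constant disappears in the little-o.
\<close>

lemma has_Lr_derivative_iff:
  "has_Lr_derivative r a b F m x \<longleftrightarrow> F \<in> Lr r a b \<and> x \<in> {a<..<b} \<and>
     (\<forall>e>0. \<exists>\<gamma>>0. \<forall>h. 0 < h \<and> h < \<gamma> \<longrightarrow>
        Lr_mean r {x - h..x + h} (\<lambda>y. F y - F x - m * (y - x)) \<le> e * h)"
proof -
  let ?M = "\<lambda>h. Lr_mean r {x - h..x + h} (\<lambda>y. F y - F x - m * (y - x))"
  let ?D = "\<lambda>h. (1 / h * (LINT t:{-h..h}|lebesgue. \<bar>F (x + t) - F x - m * t\<bar> powr r)) powr (1 / r)"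
  have "\<forall>\<^sub>F h in at_right 0. ?D h = 2 powr (1 / r) * ?M h"
    using Lr_mean_symmetric[where x = x and r = r and g = "\<lambda>y. F y - F x - m * (y - x)"]
    by (auto simp: eventually_at_right_field intro!: exI[of _ 1])
  then have "?D \<in> o[at_right 0](\<lambda>h. h) \<longleftrightarrow> (\<lambda>h. 2 powr (1 / r) * ?M h) \<in> o[at_right 0](\<lambda>h. h)"
    by (rule landau_o.small.in_cong)
  also have "\<dots> \<longleftrightarrow> ?M \<in> o[at_right 0](\<lambda>h. h)"
    by simp
  also have "\<dots> \<longleftrightarrow> (\<forall>e>0. \<forall>\<^sub>F h in at_right 0. ?M h \<le> e * \<bar>h\<bar>)"
    by (simp add: smallo_def Lr_mean_nonneg)
  also have "\<dots> \<longleftrightarrow> (\<forall>e>0. \<exists>\<gamma>>0. \<forall>h. 0 < h \<and> h < \<gamma> \<longrightarrow> ?M h \<le> e * h)"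
    by (auto simp: eventually_at_right_field imp_conjL)
  finally show ?thesis by (simp add: has_Lr_derivative_def)
qed

section \<open>Fine partitions\<close>

lemma fine_partition_finite: "fine_partition a b E \<delta> p \<Longrightarrow> finite p"
  by (auto simp: fine_partition_def tagged_partial_division_of_def)

lemma fine_partition_interval:
  assumes "fine_partition a b E \<delta> p" "(x, K) \<in> p"
  obtains c d where "K = {c..d}" "c < d" "x \<in> {c..d}" "{c..d} \<subseteq> {a..b}" "{c..d} \<subseteq> ball x (\<delta> x)" "x \<in> E"
proof -
  have tp: "p tagged_partial_division_of {a..b}"
    using assms(1) by (simp add: fine_partition_def)
  obtain c d where K: "K = cbox c d"
    using tagged_partial_division_ofD(4)[OF tp assms(2)] by blast
  have "interior K \<noteq> {}" "x \<in> E" "K \<subseteq> ball x (\<delta> x)"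
    using assms by (auto simp: fine_partition_def fine_def)
  then show ?thesis
    using that[of c d] K tagged_partial_division_ofD(2,3)[OF tp assms(2)] by (auto simp: cbox_interval)
qed

lemma fine_partition_restrict:
  assumes "fine_partition a b E \<delta> p" "q \<subseteq> p"
    and "\<And>x K. (x, K) \<in> q \<Longrightarrow> x \<in> E'" "\<And>x K. (x, K) \<in> q \<Longrightarrow> ball x (\<delta> x) \<subseteq> ball x (\<delta>' x)"
  shows "fine_partition a b E' \<delta>' q"
  using assms tagged_partial_division_subset[of p "{a..b}" q]
  unfolding fine_partition_def fine_def by blast

text \<open>
  Intervals of a partition meet in null sets only, so that their lengths add up to the measure of
  their union. With \<open>G = {a..b}\<close> this bounds the total length; with a small open \<open>G\<close> around a
  null set it makes the total length small.
\<close>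

lemma fine_partition_length_le:
  assumes p: "fine_partition a b E \<delta> p" and G: "G \<in> lmeasurable"
    and sub: "\<And>x K. (x, K) \<in> p \<Longrightarrow> K \<subseteq> G"
  shows "(\<Sum>(x, K)\<in>p. measure lborel K) \<le> measure lebesgue G"
proof -
  have K: "\<exists>c d. snd z = {c..d}" if "z \<in> p" for z
    using that by (metis p fine_partition_interval prod.collapse)
  have tp: "p tagged_partial_division_of {a..b}"
    using p by (simp add: fine_partition_def)
  have "(\<Sum>(x, K)\<in>p. measure lborel K) = (\<Sum>z\<in>p. measure lebesgue (snd z))"
    using K by (intro sum.cong) fastforce+
  also have "\<dots> = measure lebesgue (\<Union>(snd ` p))"
  proof (rule measure_negligible_finite_Union_image[symmetric])
    show "finite p" using p by (rule fine_partition_finite)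
    show "snd z \<in> lmeasurable" if "z \<in> p" for z
      using K[OF that] by auto
    show "pairwise (\<lambda>z w. negligible (snd z \<inter> snd w)) p"
    proof (rule pairwiseI)
      fix z w assume zw: "z \<in> p" "w \<in> p" "z \<noteq> w"
      then have "interior (snd z) \<inter> interior (snd w) = {}"
        using tagged_partial_division_ofD(5)[OF tp, of "fst z" "snd z" "fst w" "snd w"] by simp
      moreover have "convex (snd z \<inter> snd w)"
        using K[OF zw(1)] K[OF zw(2)] by (auto intro: convex_Int)
      ultimately show "negligible (snd z \<inter> snd w)"
        by (simp add: negligible_convex_interior)
    qed
  qed
  also have "\<dots> \<le> measure lebesgue G"
  proof (rule measure_mono_fmeasurable)
    show "\<Union>(snd ` p) \<subseteq> G" using sub by force
    show "\<Union>(snd ` p) \<in> sets lebesgue"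
      using K fine_partition_finite[OF p] by (intro sets.finite_Union) force+
  qed (rule G)
  finally show ?thesis .
qed

text \<open>
  The link between Vitali coverings and partitions: disjoint closed balls, each tagged at its centre.
\<close>

lemma fine_partition_of_balls:
  assumes "finite D"
    and "pairwise (\<lambda>i j. disjnt (cball (fst i) (snd i)) (cball (fst j) (snd j :: real))) D"
    and "\<And>x h. (x, h) \<in> D \<Longrightarrow> x \<in> E \<and> 0 < h \<and> h < \<delta> x \<and> cball x h \<subseteq> {a..b}"
  shows "fine_partition a b E \<delta> ((\<lambda>(x, h). (x, cball x h)) ` D)"
proof -
  have int: "interior (cball x h) \<inter> interior (cball x' h') = {}"
    if "(x, h) \<in> D" "(x', h') \<in> D" "(x, h) \<noteq> (x', h')" for x h x' h' :: real
  proof -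
    have "cball x h \<inter> cball x' h' = {}"
      using pairwiseD[OF assms(2) that] by (simp add: disjnt_def)
    then show ?thesis
      using interior_subset[of "cball x h"] interior_subset[of "cball x' h'"] by blast
  qed
  have box: "\<exists>u v. cball x h = cbox u v" for x h :: real
    by (metis cball_eq_atLeastAtMost cbox_interval)
  let ?p = "(\<lambda>(x, h). (x, cball x h)) ` D"
  have "?p tagged_partial_division_of {a..b}"
    unfolding tagged_partial_division_of_def
  proof (intro conjI allI impI)
    show "finite ?p" using assms(1) by simp
    fix x K assume "(x, K) \<in> ?p"
    then obtain h where h: "(x, h) \<in> D" "K = cball x h" by auto
    then show "x \<in> K" "K \<subseteq> {a..b}" "\<exists>u v. K = cbox u v"
      using assms(3)[OF h(1)] box by auto
  next
    fix x K x' K' assume *: "(x, K) \<in> ?p \<and> (x', K') \<in> ?p \<and> (x, K) \<noteq> (x', K')"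
    then obtain h h' where "(x, h) \<in> D" "K = cball x h" "(x', h') \<in> D" "K' = cball x' h'" by auto
    then show "interior K \<inter> interior K' = {}" using int * by blast
  qed
  moreover have "x \<in> E \<and> interior K \<noteq> {} \<and> K \<subseteq> ball x (\<delta> x)" if z: "(x, K) \<in> ?p" for x K
  proof -
    obtain h where h: "(x, h) \<in> D" "K = cball x h" using z by auto
    then show ?thesis
      using assms(3)[OF h(1)] by (auto simp: interior_cball)
  qed
  ultimately show ?thesis
    unfolding fine_partition_def fine_def by blast
qed

section \<open>From a primitive to generalised absolute continuity\<close>

lemma HKr_primitive_Lr: "HKr_primitive r a b f F \<Longrightarrow> F \<in> Lr r a b"
  by (simp add: HKr_primitive_def)

lemma HKr_primitive_gauge:
  assumes "HKr_primitive r a b f F" "0 < \<epsilon>"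
  obtains \<delta> where "\<And>x. x \<in> {a..b} \<Longrightarrow> 0 < \<delta> x"
    "\<And>p. fine_partition a b {a..b} \<delta> p \<Longrightarrow>
       (\<Sum>(x, K)\<in>p. Lr_mean r K (\<lambda>y. F y - F x - f x * (y - x))) < \<epsilon>"
  using assms unfolding HKr_primitive_def by blast

text \<open>
  On a set where \<open>\<bar>f\<bar> \<le> B\<close>, the increments of \<open>F\<close> over a fine partition sum to at most four times
  the total error plus four times \<open>B\<close> times the total length, and both are small.
\<close>

lemma HKr_primitive_imp_ACr:
  assumes r: "1 \<le> r" and prim: "HKr_primitive r a b f F"
    and E: "E \<subseteq> {a..b}" and B: "0 \<le> B" "\<And>x. x \<in> E \<Longrightarrow> \<bar>f x\<bar> \<le> B"
  shows "F \<in> ACr r a b E"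
proof -
  have "\<exists>\<eta>>0. \<exists>\<delta>. (\<forall>x\<in>E. 0 < \<delta> x) \<and>
        (\<forall>p. fine_partition a b E \<delta> p \<and> (\<Sum>(x, K)\<in>p. measure lborel K) < \<eta> \<longrightarrow>
           (\<Sum>(x, K)\<in>p. Lr_mean r K (\<lambda>y. F y - F x)) < \<epsilon>)" if "0 < \<epsilon>" for \<epsilon>
  proof -
    have "0 < \<epsilon> / 8" using that by simp
    obtain \<delta> where \<delta>: "\<And>x. x \<in> {a..b} \<Longrightarrow> 0 < \<delta> x"
      and sum: "\<And>p. fine_partition a b {a..b} \<delta> p \<Longrightarrow>
           (\<Sum>(x, K)\<in>p. Lr_mean r K (\<lambda>y. F y - F x - f x * (y - x))) < \<epsilon> / 8"
      by (rule HKr_primitive_gauge[OF prim \<open>0 < \<epsilon> / 8\<close>]) blast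
    \<comment> \<open>Dividing by \<open>B + 1\<close> and not by \<open>B\<close> keeps \<open>\<eta>\<close> meaningful when \<open>B = 0\<close>.\<close>
    define \<eta> where "\<eta> = \<epsilon> / (8 * (B + 1))"
    have "0 < \<eta>" using \<open>0 < \<epsilon>\<close> B by (simp add: \<eta>_def)
    have "B * \<eta> \<le> (B + 1) * \<eta>" using \<open>0 < \<eta>\<close> by simp
    also have "\<dots> = \<epsilon> / 8" using B(1) by (simp add: \<eta>_def field_simps)
    finally have B\<eta>: "B * \<eta> \<le> \<epsilon> / 8" .
    have "(\<Sum>(x, K)\<in>p. Lr_mean r K (\<lambda>y. F y - F x)) < \<epsilon>"
      if p: "fine_partition a b E \<delta> p" and len: "(\<Sum>(x, K)\<in>p. measure lborel K) < \<eta>" for p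
    proof -
      have "(\<Sum>(x, K)\<in>p. Lr_mean r K (\<lambda>y. F y - F x)) \<le>
        (\<Sum>(x, K)\<in>p. 4 * (Lr_mean r K (\<lambda>y. F y - F x - f x * (y - x)) + B * measure lborel K))"
      proof (rule sum_mono, clarify)
        fix x K assume "(x, K) \<in> p"
        then obtain c d where K: "K = {c..d}" "c < d" "x \<in> {c..d}" "{c..d} \<subseteq> {a..b}" "x \<in> E"
          using p by (elim fine_partition_interval)
        have "Lr_mean r {c..d} (\<lambda>y. F y - F x) \<le>
            4 * (Lr_mean r {c..d} (\<lambda>y. F y - F x - f x * (y - x)) + \<bar>f x\<bar> * (d - c))"
          using r K HKr_primitive_Lr[OF prim] by (intro Lr_mean_increment_le) (auto intro: Lr_subset)
        also have "\<dots> \<le> 4 * (Lr_mean r {c..d} (\<lambda>y. F y - F x - f x * (y - x)) + B * (d - c))"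
          using B(2)[OF \<open>x \<in> E\<close>] K(2) by (simp add: mult_right_mono)
        finally show "Lr_mean r K (\<lambda>y. F y - F x) \<le>
            4 * (Lr_mean r K (\<lambda>y. F y - F x - f x * (y - x)) + B * measure lborel K)"
          using K by simp
      qed
      also have "\<dots> = 4 * ((\<Sum>(x, K)\<in>p. Lr_mean r K (\<lambda>y. F y - F x - f x * (y - x)))
            + B * (\<Sum>(x, K)\<in>p. measure lborel K))"
        by (simp add: case_prod_beta sum_distrib_left sum.distrib distrib_left)
      also have "\<dots> < 4 * (\<epsilon> / 8 + \<epsilon> / 8)"
      proof -
        have "fine_partition a b {a..b} \<delta> p"
          by (rule fine_partition_restrict[OF p]) (use E in \<open>auto elim: fine_partition_interval[OF p]\<close>)
        from sum[OF this] show ?thesis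
          using mult_left_mono[OF less_imp_le[OF len] B(1)] B\<eta> by simp
      qed
      finally show ?thesis by simp
    qed
    then show ?thesis using \<open>0 < \<eta>\<close> \<delta> E by blast
  qed
  then show ?thesis
    using E HKr_primitive_Lr[OF prim] unfolding ACr_def by blast
qed

lemma HKr_primitive_imp_ACGr:
  assumes "1 \<le> r" "HKr_primitive r a b f F"
  shows "F \<in> ACGr r a b"
proof -
  let ?E = "\<lambda>n::nat. {x\<in>{a..b}. \<bar>f x\<bar> \<le> n}"
  have "F \<in> ACr r a b (?E n)" for n
    by (rule HKr_primitive_imp_ACr[OF assms, of _ n]) auto
  moreover have "{a..b} = (\<Union>n. ?E n)"
    using real_arch_simple by auto
  ultimately show ?thesis
    using HKr_primitive_Lr[OF assms(2)] unfolding ACGr_def by blast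
qed

section \<open>Almost everywhere differentiability of a primitive\<close>

lemma negligible_if_essentially_covered:
  assumes "\<And>\<epsilon>. 0 < \<epsilon> \<Longrightarrow> \<exists>U\<in>lmeasurable. negligible (S - U) \<and> measure lebesgue U \<le> \<epsilon>"
  shows "negligible S"
  unfolding negligible_outer_le
proof (intro allI impI)
  fix \<epsilon> :: real assume "0 < \<epsilon>"
  then obtain U where U: "U \<in> lmeasurable" "negligible (S - U)" "measure lebesgue U \<le> \<epsilon>"
    using assms by blast
  have R: "S - U \<in> lmeasurable" "measure lebesgue (S - U) = 0"
    using U(2) by (auto intro: negligible_imp_measurable negligible_imp_measure0)
  have "measure lebesgue (U \<union> (S - U)) \<le> measure lebesgue U + measure lebesgue (S - U)"
    using U(1) R(1) by (intro measure_Un_le) (auto simp: fmeasurableD)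
  then have "measure lebesgue (U \<union> (S - U)) \<le> \<epsilon>"
    using U(3) R(2) by linarith
  moreover have "U \<union> (S - U) \<in> lmeasurable"
    using U(1) R(1) by (rule fmeasurable.Un)
  moreover have "S \<subseteq> U \<union> (S - U)"
    by blast
  ultimately show "\<exists>T. S \<subseteq> T \<and> T \<in> lmeasurable \<and> measure lebesgue T \<le> \<epsilon>"
    by (intro exI conjI)
qed

text \<open>
  If the error at \<open>x\<close> exceeds \<open>e * h\<close> for arbitrarily small \<open>h\<close>, for every \<open>x\<close> in \<open>S\<close>, then the
  balls on which this happens and which are fine for a given gauge form a Vitali covering of \<open>S\<close>.
  Finitely many disjoint ones form a fine partition, and their total length is at most \<open>2 / e\<close> times
  the sum of its errors. That sum is as small as the gauge was chosen to make it, and the bound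
  passes to the countable disjoint family that covers almost all of \<open>S\<close>.
\<close>

lemma negligible_large_error:
  assumes prim: "HKr_primitive r a b f F" and "0 < e"
    and S: "S \<subseteq> {a<..<b}"
    and large: "\<And>x \<gamma>. x \<in> S \<Longrightarrow> 0 < \<gamma> \<Longrightarrow> \<exists>h. 0 < h \<and> h < \<gamma> \<and>
      e * h < Lr_mean r {x - h..x + h} (\<lambda>y. F y - F x - f x * (y - x))"
  shows "negligible S"
proof (rule negligible_if_essentially_covered)
  fix \<epsilon> :: real assume "0 < \<epsilon>"
  define err where "err x K = Lr_mean r K (\<lambda>y. F y - F x - f x * (y - x))" for x K
  have "0 < e * \<epsilon> / 2" using \<open>0 < e\<close> \<open>0 < \<epsilon>\<close> by simp
  obtain \<delta> where \<delta>: "\<And>x. x \<in> {a..b} \<Longrightarrow> 0 < \<delta> x"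
    and sum: "\<And>p. fine_partition a b {a..b} \<delta> p \<Longrightarrow> (\<Sum>(x, K)\<in>p. err x K) < e * \<epsilon> / 2"
    unfolding err_def by (rule HKr_primitive_gauge[OF prim \<open>0 < e * \<epsilon> / 2\<close>]) blast
  define \<V> where "\<V> = {(x, h). x \<in> {a..b} \<and> 0 < h \<and> h < \<delta> x \<and> cball x h \<subseteq> {a..b} \<and> e * h < err x (cball x h)}"
  have vitali: "\<exists>i. i \<in> \<V> \<and> x \<in> cball (fst i) (snd i) \<and> snd i < d" if "x \<in> S" "0 < d" for x d
  proof -
    define \<gamma> where "\<gamma> = min d (min (\<delta> x) (min (x - a) (b - x)))"
    have "0 < \<gamma>" using that S \<delta>[of x] by (auto simp: \<gamma>_def)
    then obtain h where h: "0 < h" "h < \<gamma>" "e * h < err x {x - h..x + h}"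
      using large[OF \<open>x \<in> S\<close>] unfolding err_def by blast
    have "h < d" "h < \<delta> x" "h < x - a" "h < b - x"
      using h(2) by (simp_all add: \<gamma>_def)
    then have "(x, h) \<in> \<V>" "h < d"
      using h(1,3) by (simp_all add: \<V>_def cball_eq_atLeastAtMost)
    then show ?thesis using h(1) by (intro exI[of _ "(x, h)"]) simp
  qed
  obtain C where C: "countable C" "C \<subseteq> \<V>"
    and disj: "pairwise (\<lambda>i j. disjnt (cball (fst i) (snd i)) (cball (fst j) (snd j))) C"
    and rest: "negligible (S - (\<Union>i\<in>C. cball (fst i) (snd i)))"
  proof (rule Vitali_covering_theorem_cballs[of \<V> snd S fst])
    show "0 < snd i" if "i \<in> \<V>" for i
      using that by (auto simp: \<V>_def)
    show "\<exists>i. i \<in> \<V> \<and> x \<in> cball (fst i) (snd i) \<and> snd i < d" if "x \<in> S" "0 < d" for x d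
      using that by (rule vitali)
  qed
  have bound: "measure lebesgue (\<Union>i\<in>D. cball (fst i) (snd i)) \<le> \<epsilon>" if "D \<subseteq> C" "finite D" for D
  proof -
    let ?q = "(\<lambda>(x, h). (x, cball x h)) ` D"
    have D: "x \<in> {a..b}" "0 < h" "h < \<delta> x" "cball x h \<subseteq> {a..b}" "e * h < err x (cball x h)"
      if "(x, h) \<in> D" for x h
      using that \<open>D \<subseteq> C\<close> C(2) unfolding \<V>_def by blast+
    have fine: "fine_partition a b {a..b} \<delta> ?q"
      using D by (intro fine_partition_of_balls[OF \<open>finite D\<close> pairwise_subset[OF disj \<open>D \<subseteq> C\<close>]]) auto
    have inj: "inj_on (\<lambda>(x, h). (x, cball x h)) D"
    proof (rule inj_onI)
      fix z w
      assume zw: "z \<in> D" "w \<in> D"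
        and eq: "(case z of (x, h) \<Rightarrow> (x, cball x h)) = (case w of (x, h) \<Rightarrow> (x, cball x h))"
      obtain x h x' h' where "z = (x, h)" "w = (x', h')"
        by (cases z, cases w)
      then show "z = w"
        using zw eq D(2)[of x h] D(2)[of x' h'] by (auto simp: cball_eq_atLeastAtMost Icc_eq_Icc)
    qed
    have "(\<Sum>(x, K)\<in>?q. err x K) = (\<Sum>(x, h)\<in>D. err x (cball x h))"
      by (subst sum.reindex[OF inj]) (simp add: case_prod_beta o_def)
    with sum[OF fine] have err: "(\<Sum>(x, h)\<in>D. err x (cball x h)) < e * \<epsilon> / 2"
      by simp
    have "e * measure lebesgue (\<Union>i\<in>D. cball (fst i) (snd i)) \<le> e * (\<Sum>i\<in>D. measure lebesgue (cball (fst i) (snd i)))"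
      using \<open>finite D\<close> \<open>0 < e\<close> by (intro mult_left_mono measure_UNION_le) auto
    also have "\<dots> = (\<Sum>(x, h)\<in>D. 2 * (e * h))"
      unfolding sum_distrib_left
      by (intro sum.cong refl) (auto simp: cball_eq_atLeastAtMost dest: D(2))
    also have "\<dots> \<le> (\<Sum>(x, h)\<in>D. 2 * err x (cball x h))"
      by (intro sum_mono) (auto dest: D(5))
    also have "\<dots> = 2 * (\<Sum>(x, h)\<in>D. err x (cball x h))"
      by (simp add: sum_distrib_left case_prod_beta)
    finally have "e * measure lebesgue (\<Union>i\<in>D. cball (fst i) (snd i)) \<le> e * \<epsilon>"
      using err by simp
    then show ?thesis using \<open>0 < e\<close> by simp
  qed
  let ?U = "\<Union>i\<in>C. cball (fst i) (snd i)"
  have U: "?U \<in> lmeasurable" "measure lebesgue ?U \<le> \<epsilon>"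
    using fmeasurable_UN_bound[OF C(1) _ bound] measure_UN_bound[OF C(1) _ bound] by simp_all
  show "\<exists>U\<in>lmeasurable. negligible (S - U) \<and> measure lebesgue U \<le> \<epsilon>"
  proof (rule bexI[of _ ?U])
    show "negligible (S - ?U) \<and> measure lebesgue ?U \<le> \<epsilon>"
      using rest U(2) by (rule conjI)
  qed (rule U(1))
qed

lemma AE_lebesgue_on_Icc_iff:
  "(AE x in lebesgue_on {a..b::real}. P x) \<longleftrightarrow> negligible {x\<in>{a..b}. \<not> P x}"
proof -
  have "(AE x in lebesgue_on {a..b}. P x) \<longleftrightarrow> (AE x in lebesgue. x \<in> {a..b} \<longrightarrow> P x)"
    by (rule AE_restrict_space_iff) simp
  also have "\<dots> \<longleftrightarrow> (\<exists>N. negligible N \<and> {x. \<not> (x \<in> {a..b} \<longrightarrow> P x)} \<subseteq> N)"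
    by (auto simp: eventually_ae_filter negligible_iff_null_sets)
  also have "\<dots> \<longleftrightarrow> negligible {x\<in>{a..b}. \<not> P x}"
    by (auto intro: negligible_subset)
  finally show ?thesis .
qed

text \<open>
  The points of \<open>{a<..<b}\<close> at which \<open>f x\<close> is not the derivative lie in the union, over the
  thresholds \<open>e = 1 / (n + 1)\<close>, of sets of large error.
\<close>

lemma HKr_primitive_imp_AE_derivative:
  assumes "HKr_primitive r a b f F"
  shows "AE x in lebesgue_on {a..b}. has_Lr_derivative r a b F (f x) x"
proof -
  let ?err = "\<lambda>x h. Lr_mean r {x - h..x + h} (\<lambda>y. F y - F x - f x * (y - x))"
  let ?S = "\<lambda>e. {x\<in>{a<..<b}. \<forall>\<gamma>>0. \<exists>h. 0 < h \<and> h < \<gamma> \<and> e * h < ?err x h}"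
  have "negligible ({a, b} \<union> (\<Union>n. ?S (inverse (real (Suc n)))))"
  proof (intro negligible_Un negligible_countable_Union)
    show "negligible X" if X': "X \<in> range (\<lambda>n. ?S (inverse (real (Suc n))))" for X
    proof -
      obtain n where X: "X = ?S (inverse (real (Suc n)))" using X' by blast
      show ?thesis
        by (rule negligible_large_error[OF assms, of "inverse (real (Suc n))"]) (auto simp: X)
    qed
  qed simp_all
  moreover have "{x\<in>{a..b}. \<not> has_Lr_derivative r a b F (f x) x} \<subseteq> {a, b} \<union> (\<Union>n. ?S (inverse (real (Suc n))))"
  proof (rule subsetI, rule ccontr)
    fix x
    assume x: "x \<in> {x\<in>{a..b}. \<not> has_Lr_derivative r a b F (f x) x}"
      "x \<notin> {a, b} \<union> (\<Union>n. ?S (inverse (real (Suc n))))"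
    then have "x \<in> {a<..<b}" by auto
    then obtain e where "0 < e" and e: "\<And>\<gamma>. 0 < \<gamma> \<Longrightarrow> \<exists>h. 0 < h \<and> h < \<gamma> \<and> e * h < ?err x h"
      using x(1) HKr_primitive_Lr[OF assms] unfolding has_Lr_derivative_iff mem_Collect_eq by (meson not_le)
    obtain n where n: "inverse (real (Suc n)) < e"
      using reals_Archimedean[OF \<open>0 < e\<close>] by blast
    have "\<exists>h. 0 < h \<and> h < \<gamma> \<and> inverse (real (Suc n)) * h < ?err x h" if \<gamma>: "0 < \<gamma>" for \<gamma>
    proof -
      obtain h where h: "0 < h" "h < \<gamma>" "e * h < ?err x h" using e[OF \<gamma>] by blast
      moreover have "inverse (real (Suc n)) * h \<le> e * h"
        using n h(1) by (intro mult_right_mono) auto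
      ultimately show ?thesis by (meson le_less_trans)
    qed
    then show False using x(2) \<open>x \<in> {a<..<b}\<close> by blast
  qed
  ultimately show ?thesis
    unfolding AE_lebesgue_on_Icc_iff by (rule negligible_subset)
qed

section \<open>From generalised absolute continuity to a primitive\<close>

lemma ACr_subset:
  assumes "F \<in> ACr r a b E" "E' \<subseteq> E"
  shows "F \<in> ACr r a b E'"
proof -
  have "\<exists>\<eta>>0. \<exists>\<delta>. (\<forall>x\<in>E'. 0 < \<delta> x) \<and>
        (\<forall>p. fine_partition a b E' \<delta> p \<and> (\<Sum>(x, K)\<in>p. measure lborel K) < \<eta> \<longrightarrow>
           (\<Sum>(x, K)\<in>p. Lr_mean r K (\<lambda>y. F y - F x)) < \<epsilon>)" if "0 < \<epsilon>" for \<epsilon>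
  proof -
    have "\<exists>\<eta>>0. \<exists>\<delta>. (\<forall>x\<in>E. 0 < \<delta> x) \<and>
        (\<forall>p. fine_partition a b E \<delta> p \<and> (\<Sum>(x, K)\<in>p. measure lborel K) < \<eta> \<longrightarrow>
           (\<Sum>(x, K)\<in>p. Lr_mean r K (\<lambda>y. F y - F x)) < \<epsilon>)"
      using assms(1) that unfolding ACr_def by blast
    moreover have "fine_partition a b E \<delta> p" if "fine_partition a b E' \<delta> p" for \<delta> p
      using that assms(2) unfolding fine_partition_def by blast
    ultimately show ?thesis
      using assms(2) by (meson subsetD)
  qed
  then show ?thesis
    using assms unfolding ACr_def by blast
qed

text \<open>
  Cutting each \<open>E m\<close> by the level sets \<open>\<bar>f\<bar> \<le> k\<close> gives a doubly indexed family. It is enumerated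
  by the Cantor pairing, whose code for \<open>(m, k)\<close> is at least \<open>k\<close>; hence the index of a piece itself
  bounds \<open>\<bar>f\<bar>\<close> there.
\<close>

lemma ACGr_bounded_pieces:
  fixes f :: "real \<Rightarrow> real"
  assumes "F \<in> ACGr r a b"
  obtains E :: "nat \<Rightarrow> real set" where "{a..b} = (\<Union>n. E n)" "\<And>n. F \<in> ACr r a b (E n)"
    "\<And>n x. x \<in> E n \<Longrightarrow> \<bar>f x\<bar> \<le> n"
proof -
  obtain E :: "nat \<Rightarrow> real set" where E: "{a..b} = (\<Union>n. E n)" "\<And>n. F \<in> ACr r a b (E n)"
    using assms unfolding ACGr_def by blast
  define E' where "E' n = {x \<in> E (fst (prod_decode n)). \<bar>f x\<bar> \<le> snd (prod_decode n)}" for n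
  show ?thesis
  proof (rule that[of E'])
    show "{a..b} = (\<Union>n. E' n)"
    proof (intro equalityI subsetI)
      fix x assume "x \<in> {a..b}"
      then obtain m k where "x \<in> E m" "\<bar>f x\<bar> \<le> real k"
        using E(1) real_arch_simple by blast
      then have "x \<in> E' (prod_encode (m, k))"
        by (simp add: E'_def)
      then show "x \<in> (\<Union>n. E' n)" by blast
    qed (use E(1) in \<open>auto simp: E'_def\<close>)
    show "F \<in> ACr r a b (E' n)" for n
      by (rule ACr_subset[OF E(2)]) (auto simp: E'_def)
    show "\<bar>f x\<bar> \<le> n" if "x \<in> E' n" for x n
    proof -
      have "snd (prod_decode n) \<le> n"
        using le_prod_encode_2[of "snd (prod_decode n)" "fst (prod_decode n)"] by simp
      then show ?thesis using that by (simp add: E'_def)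
    qed
  qed
qed

lemma negligible_outer_open:
  fixes N :: "real set"
  assumes "negligible N" "0 < e"
  obtains G where "open G" "N \<subseteq> G" "G \<in> lmeasurable" "measure lebesgue G < e"
proof -
  obtain G where G: "open G" "N \<subseteq> G" "G - N \<in> lmeasurable" "emeasure lebesgue (G - N) < ennreal e"
    using assms negligible_imp_sets by (metis sets_lebesgue_outer_open)
  have "N \<in> lmeasurable" "measure lebesgue N = 0"
    using assms(1) by (auto intro: negligible_imp_measurable negligible_imp_measure0)
  moreover have "G = (G - N) \<union> N" using G(2) by blast
  moreover have "measure lebesgue (G - N) < e"
    using G(3,4) assms(2) by (simp add: emeasure_eq_measure2 ennreal_less_iff)
  ultimately have "G \<in> lmeasurable" "measure lebesgue G < e"
    using G(3) measure_Un_le[of "G - N" lebesgue N] fmeasurable.Un[of "G - N" lebesgue N]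
    by (auto simp: fmeasurableD)
  then show ?thesis using that G by blast
qed

text \<open>
  An interval \<open>{c..d}\<close> around \<open>x\<close> lies in \<open>{x - h..x + h}\<close>, where \<open>h\<close> is the distance from \<open>x\<close> to
  the farther endpoint. Since \<open>h \<le> d - c\<close>, passing to the symmetric interval at most doubles the
  length, and an error of order \<open>o(h)\<close> is also of order \<open>o(d - c)\<close>.
\<close>

lemma derivative_gauge:
  assumes r: "1 \<le> r" and der: "has_Lr_derivative r a b F m x" and "0 < e"
  obtains \<gamma> where "0 < \<gamma>"
    "\<And>c d. \<lbrakk>c < d; x \<in> {c..d}; {c..d} \<subseteq> ball x \<gamma>\<rbrakk> \<Longrightarrow>
       Lr_mean r {c..d} (\<lambda>y. F y - F x - m * (y - x)) \<le> e * (d - c)"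
proof -
  let ?g = "\<lambda>y. F y - F x - m * (y - x)"
  have F: "F \<in> Lr r a b" and x: "a < x" "x < b"
    using der by (auto simp: has_Lr_derivative_iff)
  have "0 < e / 2" using \<open>0 < e\<close> by simp
  then obtain \<gamma> where \<gamma>: "0 < \<gamma>" "\<And>h. 0 < h \<Longrightarrow> h < \<gamma> \<Longrightarrow> Lr_mean r {x - h..x + h} ?g \<le> e / 2 * h"
    using der unfolding has_Lr_derivative_iff by blast
  show ?thesis
  proof (rule that[of "min \<gamma> (min (x - a) (b - x))"])
    show "0 < min \<gamma> (min (x - a) (b - x))" using \<gamma> x by simp
    fix c d assume cd: "c < d" "x \<in> {c..d}" "{c..d} \<subseteq> ball x (min \<gamma> (min (x - a) (b - x)))"
    define h where "h = max (x - c) (d - x)"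
    have "c \<in> {c..d}" "d \<in> {c..d}" using cd(1) by auto
    then have "c \<in> ball x (min \<gamma> (min (x - a) (b - x)))" "d \<in> ball x (min \<gamma> (min (x - a) (b - x)))"
      using cd(3) by blast+
    then have h: "0 < h" "h < \<gamma>" "a \<le> x - h" "x + h \<le> b" "h \<le> d - c" "{c..d} \<subseteq> {x - h..x + h}"
      using cd(1,2) by (auto simp: h_def dist_real_def)
    have "Lr_mean r {c..d} ?g \<le> 2 * Lr_mean r {x - h..x + h} ?g"
    proof (rule Lr_mean_subinterval_le[OF r cd(1) h(6)])
      show "?g \<in> Lr r (x - h) (x + h)"
        using r h Lr_subset[OF F] by (intro Lr_add_affine) auto
    qed (use h in simp)
    also have "\<dots> \<le> e * h" using \<gamma>(2)[OF h(1,2)] by simp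
    also have "\<dots> \<le> e * (d - c)" using h(5) \<open>0 < e\<close> by simp
    finally show "Lr_mean r {c..d} ?g \<le> e * (d - c)" .
  qed
qed

text \<open>
  Over a null set neither summand of the error can contribute: a gauge that keeps all intervals
  inside an open set of small measure makes their total length small, which controls the increments
  of \<open>F\<close> by absolute continuity and the linear terms by the bound on \<open>f\<close>.
\<close>

lemma ACr_null_gauge:
  assumes r: "1 \<le> r" and AC: "F \<in> ACr r a b E" and f: "\<And>x. x \<in> E \<Longrightarrow> \<bar>f x\<bar> \<le> B" and "0 \<le> B"
    and N: "negligible N" "N \<subseteq> E" and "0 < e"
  obtains \<delta> where "\<And>x. x \<in> N \<Longrightarrow> 0 < \<delta> x"
    "\<And>p. fine_partition a b N \<delta> p \<Longrightarrow>
       (\<Sum>(x, K)\<in>p. Lr_mean r K (\<lambda>y. F y - F x - f x * (y - x))) \<le> e"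
proof -
  have "F \<in> ACr r a b N" using AC N(2) by (rule ACr_subset)
  moreover have "0 < e / 8" using \<open>0 < e\<close> by simp
  ultimately obtain \<eta> \<delta> where "0 < \<eta>" and \<delta>: "\<And>x. x \<in> N \<Longrightarrow> 0 < \<delta> x"
    and small: "\<And>p. fine_partition a b N \<delta> p \<Longrightarrow> (\<Sum>(x, K)\<in>p. measure lborel K) < \<eta> \<Longrightarrow>
         (\<Sum>(x, K)\<in>p. Lr_mean r K (\<lambda>y. F y - F x)) < e / 8"
    unfolding ACr_def by blast
  have F: "F \<in> Lr r a b" using AC by (simp add: ACr_def)
  define \<theta> where "\<theta> = min \<eta> (e / (8 * (B + 1)))"
  have "0 < \<theta>" using \<open>0 < \<eta>\<close> \<open>0 < e\<close> \<open>0 \<le> B\<close> by (simp add: \<theta>_def)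
  have "B * \<theta> \<le> (B + 1) * (e / (8 * (B + 1)))"
    using \<open>0 < \<theta>\<close> \<open>0 \<le> B\<close> by (intro mult_mono) (auto simp: \<theta>_def)
  also have "\<dots> = e / 8" using \<open>0 \<le> B\<close> by (simp add: field_simps)
  finally have B\<theta>: "B * \<theta> \<le> e / 8" .
  obtain G where G: "open G" "N \<subseteq> G" "G \<in> lmeasurable" "measure lebesgue G < \<theta>"
    using negligible_outer_open[OF N(1) \<open>0 < \<theta>\<close>] by blast
  have "\<exists>\<rho>>0. ball x \<rho> \<subseteq> G" if "x \<in> N" for x
    using G(1,2) that open_contains_ball by blast
  then obtain \<rho> where \<rho>: "\<And>x. x \<in> N \<Longrightarrow> 0 < \<rho> x" "\<And>x. x \<in> N \<Longrightarrow> ball x (\<rho> x) \<subseteq> G"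
    by metis
  show ?thesis
  proof (rule that[of "\<lambda>x. min (\<delta> x) (\<rho> x)"])
    show "0 < min (\<delta> x) (\<rho> x)" if "x \<in> N" for x using \<delta> \<rho>(1) that by simp
    fix p assume p: "fine_partition a b N (\<lambda>x. min (\<delta> x) (\<rho> x)) p"
    have sub: "K \<subseteq> G" if "(x, K) \<in> p" for x K
      using p that
    proof (rule fine_partition_interval)
      fix c d assume "K = {c..d}" "{c..d} \<subseteq> ball x (min (\<delta> x) (\<rho> x))" "x \<in> N"
      moreover have "ball x (min (\<delta> x) (\<rho> x)) \<subseteq> ball x (\<rho> x)"
        by (rule subset_ball) simp
      ultimately show "K \<subseteq> G" using \<rho>(2)[of x] by blast
    qed
    have "(\<Sum>(x, K)\<in>p. measure lborel K) \<le> measure lebesgue G"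
      using p G(3) sub by (rule fine_partition_length_le)
    then have len: "(\<Sum>(x, K)\<in>p. measure lborel K) < \<theta>"
      using G(4) by (rule le_less_trans)
    have fine: "fine_partition a b N \<delta> p"
      by (rule fine_partition_restrict[OF p]) (auto elim: fine_partition_interval[OF p])
    have "(\<Sum>(x, K)\<in>p. Lr_mean r K (\<lambda>y. F y - F x - f x * (y - x))) \<le>
        (\<Sum>(x, K)\<in>p. 4 * (Lr_mean r K (\<lambda>y. F y - F x) + B * measure lborel K))"
    proof (rule sum_mono, clarify)
      fix x K assume "(x, K) \<in> p"
      then obtain c d where K: "K = {c..d}" "c < d" "x \<in> {c..d}" "{c..d} \<subseteq> {a..b}" "x \<in> N"
        using p by (elim fine_partition_interval)
      have "Lr_mean r {c..d} (\<lambda>y. F y - F x - f x * (y - x)) \<le>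
          4 * (Lr_mean r {c..d} (\<lambda>y. F y - F x) + \<bar>f x\<bar> * (d - c))"
        using r K Lr_subset[OF F] by (intro Lr_mean_error_le) auto
      also have "\<dots> \<le> 4 * (Lr_mean r {c..d} (\<lambda>y. F y - F x) + B * (d - c))"
        using f[of x] N(2) K by (auto intro: mult_right_mono)
      finally show "Lr_mean r K (\<lambda>y. F y - F x - f x * (y - x)) \<le>
          4 * (Lr_mean r K (\<lambda>y. F y - F x) + B * measure lborel K)"
        using K by simp
    qed
    also have "\<dots> = 4 * ((\<Sum>(x, K)\<in>p. Lr_mean r K (\<lambda>y. F y - F x))
          + B * (\<Sum>(x, K)\<in>p. measure lborel K))"
      by (simp add: case_prod_beta sum_distrib_left sum.distrib distrib_left)
    also have "\<dots> \<le> 4 * (e / 8 + e / 8)"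
      using small[OF fine] len mult_left_mono[OF less_imp_le[OF len] \<open>0 \<le> B\<close>] B\<theta>
      by (simp add: \<theta>_def)
    finally show "(\<Sum>(x, K)\<in>p. Lr_mean r K (\<lambda>y. F y - F x - f x * (y - x))) \<le> e" by simp
  qed
qed

text \<open>
  The gauge is chosen pointwise. At points of differentiability the error is a small multiple of the
  length, which sums to a small multiple of \<open>b - a\<close>. The exceptional null set \<open>N\<close> is split into the
  disjoint pieces \<open>N' n\<close> of points whose first index is \<open>n\<close>, on which \<open>f\<close> is bounded and \<open>F\<close> is
  absolutely continuous; their contributions are at most the terms of a geometric series.
\<close>

theorem HKr_primitive_if_AE_derivative:
  assumes r: "1 \<le> r" and ab: "a < b" and ACG: "F \<in> ACGr r a b"
    and der: "AE x in lebesgue_on {a..b}. has_Lr_derivative r a b F (f x) x"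
  shows "HKr_primitive r a b f F"
proof -
  let ?err = "\<lambda>x K. Lr_mean r K (\<lambda>y. F y - F x - f x * (y - x))"
  define N where "N = {x\<in>{a..b}. \<not> has_Lr_derivative r a b F (f x) x}"
  have N: "negligible N" using der by (simp add: AE_lebesgue_on_Icc_iff N_def)
  obtain E :: "nat \<Rightarrow> real set" where E: "{a..b} = (\<Union>n. E n)" "\<And>n. F \<in> ACr r a b (E n)"
    "\<And>n x. x \<in> E n \<Longrightarrow> \<bar>f x\<bar> \<le> n"
    using ACGr_bounded_pieces[OF ACG, of f] by blast
  define idx where "idx x = (LEAST n. x \<in> E n)" for x
  have idx: "x \<in> E (idx x)" if "x \<in> {a..b}" for x
    using that E(1) unfolding idx_def by (auto intro: LeastI)
  define N' where "N' n = {x\<in>N. idx x = n}" for n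
  have N': "negligible (N' n)" "N' n \<subseteq> E n" for n
    using idx by (auto simp: N'_def N_def intro: negligible_subset[OF N])
  have "\<exists>\<delta>. (\<forall>x\<in>{a..b}. 0 < \<delta> x) \<and>
      (\<forall>p. fine_partition a b {a..b} \<delta> p \<longrightarrow> (\<Sum>(x, K)\<in>p. ?err x K) < \<epsilon>)" if "0 < \<epsilon>" for \<epsilon>
  proof -
    define \<epsilon>' where "\<epsilon>' n = \<epsilon> / 8 * (1 / 2) ^ n" for n :: nat
    have \<epsilon>'_pos: "0 < \<epsilon>' n" for n using \<open>0 < \<epsilon>\<close> by (simp add: \<epsilon>'_def)
    have "\<forall>n. \<exists>\<delta>. (\<forall>x\<in>N' n. 0 < \<delta> x) \<and>
        (\<forall>p. fine_partition a b (N' n) \<delta> p \<longrightarrow> (\<Sum>(x, K)\<in>p. ?err x K) \<le> \<epsilon>' n)"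
    proof
      show "\<exists>\<delta>. (\<forall>x\<in>N' n. 0 < \<delta> x) \<and>
        (\<forall>p. fine_partition a b (N' n) \<delta> p \<longrightarrow> (\<Sum>(x, K)\<in>p. ?err x K) \<le> \<epsilon>' n)" for n
        by (rule ACr_null_gauge[OF r E(2) E(3) _ N' \<epsilon>'_pos, of n]) auto
    qed
    from choice[OF this] obtain \<delta> where \<delta>: "\<And>n x. x \<in> N' n \<Longrightarrow> 0 < \<delta> n x"
      and null: "\<And>n p. fine_partition a b (N' n) (\<delta> n) p \<Longrightarrow> (\<Sum>(x, K)\<in>p. ?err x K) \<le> \<epsilon>' n"
      by blast
    define e where "e = \<epsilon> / (2 * (b - a))"
    have "0 < e" using \<open>0 < \<epsilon>\<close> ab by (simp add: e_def)
    have "\<forall>x\<in>{a..b} - N. \<exists>\<gamma>>0. \<forall>c d. c < d \<and> x \<in> {c..d} \<and> {c..d} \<subseteq> ball x \<gamma> \<longrightarrow>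
        ?err x {c..d} \<le> e * (d - c)"
    proof
      fix x assume "x \<in> {a..b} - N"
      then have der_x: "has_Lr_derivative r a b F (f x) x" by (simp add: N_def)
      show "\<exists>\<gamma>>0. \<forall>c d. c < d \<and> x \<in> {c..d} \<and> {c..d} \<subseteq> ball x \<gamma> \<longrightarrow> ?err x {c..d} \<le> e * (d - c)"
        by (rule derivative_gauge[OF r der_x \<open>0 < e\<close>]) blast
    qed
    from bchoice[OF this] obtain \<gamma> where \<gamma>: "\<And>x. x \<in> {a..b} - N \<Longrightarrow> 0 < \<gamma> x"
      and good: "\<And>x c d. \<lbrakk>x \<in> {a..b} - N; c < d; x \<in> {c..d}; {c..d} \<subseteq> ball x (\<gamma> x)\<rbrakk> \<Longrightarrow>
          ?err x {c..d} \<le> e * (d - c)"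
      by blast
    define \<kappa> where "\<kappa> x = (if x \<in> N then \<delta> (idx x) x else \<gamma> x)" for x
    have "0 < \<kappa> x" if "x \<in> {a..b}" for x
      using that \<delta>[of x "idx x"] \<gamma>[of x] by (auto simp: \<kappa>_def N'_def)
    moreover have "(\<Sum>(x, K)\<in>p. ?err x K) < \<epsilon>" if p: "fine_partition a b {a..b} \<kappa> p" for p
    proof -
      have fin: "finite p" using p by (rule fine_partition_finite)
      define q where "q = {z\<in>p. fst z \<in> N}"
      have q: "finite q" "q \<subseteq> p" using fin by (auto simp: q_def)
      \<comment> \<open>\<open>q\<close> has only finitely many tags, hence meets only finitely many of the pieces.\<close>
      have "(\<Sum>(x, K)\<in>q. ?err x K)
          = (\<Sum>n\<in>(\<lambda>z. idx (fst z)) ` q. \<Sum>(x, K)\<in>{z\<in>q. idx (fst z) = n}. ?err x K)"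
        using q(1) by (rule sum.image_gen)
      also have "\<dots> \<le> (\<Sum>n\<in>(\<lambda>z. idx (fst z)) ` q. \<epsilon>' n)"
      proof (rule sum_mono)
        fix n
        have "fine_partition a b (N' n) (\<delta> n) {z\<in>q. idx (fst z) = n}"
          by (rule fine_partition_restrict[OF p]) (auto simp: q_def N'_def \<kappa>_def)
        then show "(\<Sum>(x, K)\<in>{z\<in>q. idx (fst z) = n}. ?err x K) \<le> \<epsilon>' n" by (rule null)
      qed
      also have "\<dots> \<le> (\<Sum>n. \<epsilon>' n)"
        using q(1) \<epsilon>'_pos by (intro sum_le_suminf) (auto simp: \<epsilon>'_def less_imp_le)
      also have "\<dots> = \<epsilon> / 4"
        unfolding \<epsilon>'_def by (subst suminf_mult) (simp_all add: suminf_geometric)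
      finally have bad: "(\<Sum>(x, K)\<in>q. ?err x K) \<le> \<epsilon> / 4" .
      have "(\<Sum>(x, K)\<in>p - q. ?err x K) \<le> (\<Sum>(x, K)\<in>p - q. e * measure lborel K)"
      proof (rule sum_mono, clarify)
        fix x K assume z: "(x, K) \<in> p" "(x, K) \<notin> q"
        obtain c d where K: "K = {c..d}" "c < d" "x \<in> {c..d}" "{c..d} \<subseteq> ball x (\<kappa> x)" "x \<in> {a..b}"
          using p z(1) by (elim fine_partition_interval)
        moreover have "x \<notin> N" using z by (auto simp: q_def)
        ultimately show "?err x K \<le> e * measure lborel K"
          using good[of x c d] by (simp add: \<kappa>_def)
      qed
      also have "\<dots> \<le> (\<Sum>(x, K)\<in>p. e * measure lborel K)"
        using fin \<open>0 < e\<close> by (intro sum_mono2) auto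
      also have "\<dots> = e * (\<Sum>(x, K)\<in>p. measure lborel K)"
        by (simp add: sum_distrib_left case_prod_beta)
      also have "\<dots> \<le> e * measure lebesgue {a..b}"
        using \<open>0 < e\<close> by (intro mult_left_mono fine_partition_length_le[OF p])
          (auto elim: fine_partition_interval[OF p])
      also have "\<dots> = \<epsilon> / 2" using ab by (simp add: e_def divide_simps)
      finally have "(\<Sum>(x, K)\<in>p - q. ?err x K) \<le> \<epsilon> / 2" .
      moreover have "(\<Sum>(x, K)\<in>p. ?err x K) = (\<Sum>(x, K)\<in>p - q. ?err x K) + (\<Sum>(x, K)\<in>q. ?err x K)"
        using q(2) fin by (rule sum.subset_diff)
      ultimately show ?thesis using bad \<open>0 < \<epsilon>\<close> by simp
    qed
    ultimately show ?thesis by blast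
  qed
  then show ?thesis
    using ACG unfolding HKr_primitive_def ACGr_def by blast
qed

lemma HKr_primitive_minus_const:
  assumes "1 \<le> r" "HKr_primitive r a b f F"
  shows "HKr_primitive r a b f (\<lambda>x. F x - k)"
proof -
  have "(\<lambda>x. F x - k) \<in> Lr r a b"
    using Lr_add_affine[of r F a b k 0] assms HKr_primitive_Lr[OF assms(2)] by simp
  then show ?thesis using assms(2) by (simp add: HKr_primitive_def)
qed

theorem theorem13:
  fixes r a b :: real and f :: "real \<Rightarrow> real"
  assumes "1 \<le> r" and "a < b"
  shows "(HKr_integrable r a b f \<longleftrightarrow>
            (\<exists>F \<in> ACGr r a b. AE x in lebesgue_on {a..b}. has_Lr_derivative r a b F (f x) x)) \<and>
         (\<forall>F \<in> ACGr r a b. (AE x in lebesgue_on {a..b}. has_Lr_derivative r a b F (f x) x) \<longrightarrow>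
            has_indefinite_HKr_integral r a b f (\<lambda>x. F x - F a))"
proof (intro conjI ballI impI iffI)
  assume "HKr_integrable r a b f"
  then obtain F where "HKr_primitive r a b f F"
    unfolding HKr_integrable_def by blast
  then show "\<exists>F \<in> ACGr r a b. AE x in lebesgue_on {a..b}. has_Lr_derivative r a b F (f x) x"
    using HKr_primitive_imp_ACGr[OF assms(1)] HKr_primitive_imp_AE_derivative by blast
next
  assume "\<exists>F \<in> ACGr r a b. AE x in lebesgue_on {a..b}. has_Lr_derivative r a b F (f x) x"
  then show "HKr_integrable r a b f"
    using HKr_primitive_if_AE_derivative[OF assms] unfolding HKr_integrable_def by blast
next
  fix F
  assume "F \<in> ACGr r a b" "AE x in lebesgue_on {a..b}. has_Lr_derivative r a b F (f x) x"
  then have "HKr_primitive r a b f F"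
    by (rule HKr_primitive_if_AE_derivative[OF assms])
  then show "has_indefinite_HKr_integral r a b f (\<lambda>x. F x - F a)"
    using HKr_primitive_minus_const[OF assms(1)] by (simp add: has_indefinite_HKr_integral_def)
qed

end
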